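(* Let $m,n,G,T\ge 1$ be integers and let $\varrho>0$. For $s\in[T]$ let $\Psi(s)\in\mathbb{C}^{m\times n}$ satisfy $\Psi(s)\Psi(s)^\dagger=I_m$, let $A\in\mathbb{C}^{n\times G}$ be the dictionary matrix, and let $x(s)=\Psi(s)h(s)+z(s)\in\mathbb{C}^m$, $s\in[T]$, be the noisy sketches of the signal samples $h(s)\in\mathbb{C}^n$ (setting described in the context). Define, for $C=[c(1),\dots,c(T)]\in\mathbb{C}^{G\times T}$, $$f(C)=\frac12\sum_{s\in[T]}\|x(s)-\Psi(s)A\,c(s)\|_2^2+\varrho\sqrt{T}\,\|C\|_{2,1},$$ and, for $\gamma=(\gamma_1,\dots,\gamma_G)^{\mathsf T}\in\mathbb{R}_+^G$ with $\Gamma=\mathrm{diag}(\gamma)$, $$g(\gamma)=\frac1T\sum_{s\in[T]}x(s)^\dagger\big(\Psi(s)A\Gamma A^\dagger\Psi(s)^\dagger+\varrho I_m\big)^{-1}x(s)+\mathrm{tr}(\Gamma).$$ Let $\widehat C=\arg\min_{C\in\mathbb{C}^{G\times T}}f(C)$ and $\widehat\gamma=\arg\min_{\gamma\in\mathbb{R}_+^G}g(\gamma)$ be the optimal solutions of the convex functions $f$ and $g$, respectively. Let $\widehat h(s)=A\widehat c(s)$ be the estimate of the signal sample $h(s)$ produced by minimizing $f$, where $\widehat c(s)$ denotes the $s$-th column of the optimal solution $\widehat C$. Then $\widehat h(s)$ is given by $$\widehat h(s)=A\widehat\Gamma A^\dagger\Psi(s)^\dagger\Big(\Psi(s)A\widehat\Gamma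 A^\dagger\Psi(s)^\dagger+\varrho I_m\Big)^{-1}x(s),$$ where $\widehat\Gamma=\mathrm{diag}(\widehat\gamma)$.
   Context: Notation: $[N]=\{1,\dots,N\}$; $\dagger$ is conjugate transpose; $I_m$ is the $m\times m$ identity; $\mathbb{R}_+=[0,\infty)$; $\mathrm{tr}$ is the trace; $C_{i,:}$ is the $i$-th row of $C$ and $c(s)$ its $s$-th column; $\|C\|_{2,1}=\sum_{i\in[G]}\|C_{i,:}\|_2$; $\mathrm{diag}(\gamma)$ is the $G\times G$ diagonal matrix with diagonal entries $\gamma_1,\dots,\gamma_G$. The index $s$ in the conclusion is any element of $[T]$. Setting: $\{a(\xi):\xi\in\Xi\}\subset\mathbb{C}^n$ is a dictionary of atoms labelled by a finite or infinite set $\Xi$. The signal samples share a common support $\{\xi_1,\dots,\xi_k\}\subset\Xi$: $h(s)=\sum_{i=1}^k w_i(s)a(\xi_i)$ with (random) coefficients $w_i(s)\in\mathbb{C}$, $s\in[T]$. The sketches are $x(s)=\Psi(s)h(s)+z(s)$ with noise $z(s)\in\mathbb{C}^m$. The dictionary matrix is $A=[a(\xi_1^\circ),\dots,a(\xi_G^\circ)]\in\mathbb{C}^{n\times G}$ for a finite grid $\{\xi_1^\circ,\dots,\xi_G^\circ\}$, which need not contain the true support.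
   Formalization: Minimizers of f and g need not be unique and the formula can fail for an arbitrary pair; it is stated for all pairs when all minimizers of f give the same estimate, and otherwise each minimizer of f is matched with some minimizer of g satisfying the formula, and conversely. *)

theory Defs
  imports "HOL-Analysis.Analysis"
begin

definition conj_transpose :: "complex^'c^'r \<Rightarrow> complex^'r^'c"  ("(_\<^sup>\<dagger>)" [1000] 1000)
  where "M\<^sup>\<dagger> = (\<chi> i j. cnj (M $ j $ i))"

text \<open>The scalar \<open>x\<^sup>\<dagger> y\<close>; unlike the real-valued inner product of the library it is complex.\<close>

definition cdot :: "complex^'r \<Rightarrow> complex^'r \<Rightarrow> complex"
  where "cdot x y = (\<Sum>i\<in>UNIV. cnj (x $ i) * y $ i)"

definition diag_mat :: "real^'g \<Rightarrow> complex^'g^'g"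
  where "diag_mat \<gamma> = (\<chi> i j. if i = j then complex_of_real (\<gamma> $ i) else 0)"

definition norm21 :: "complex^'t^'g \<Rightarrow> real"
  where "norm21 C = (\<Sum>i\<in>UNIV. norm (row i C))"

definition dictionary :: "('l \<Rightarrow> complex^'n) \<Rightarrow> ('g \<Rightarrow> 'l) \<Rightarrow> complex^'g^'n"
  where "dictionary a grid = (\<chi> i j. a (grid j) $ i)"

definition nonneg_orthant :: "(real^'g) set"
  where "nonneg_orthant = {\<gamma>. \<forall>i. 0 \<le> \<gamma> $ i}"

text \<open>The sample index set \<open>[T]\<close> is the finite type \<open>'t\<close>, so \<open>T = CARD('t)\<close>.\<close>

definition lasso_obj ::
    "real \<Rightarrow> ('t::finite \<Rightarrow> complex^'n^'m) \<Rightarrow> complex^'g^'n \<Rightarrow> ('t \<Rightarrow> complex^'m)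
      \<Rightarrow> complex^'t^'g \<Rightarrow> real"
  where "lasso_obj \<rho> \<Psi> A x C =
    1/2 * (\<Sum>s\<in>UNIV. (norm (x s - (\<Psi> s ** A) *v column s C))\<^sup>2)
      + \<rho> * sqrt (real CARD('t)) * norm21 C"

definition model_cov ::
    "real \<Rightarrow> complex^'n^'m \<Rightarrow> complex^'g^'n \<Rightarrow> real^'g \<Rightarrow> complex^'m^'m"
  where "model_cov \<rho> P A \<gamma> = P ** A ** diag_mat \<gamma> ** A\<^sup>\<dagger> ** P\<^sup>\<dagger> + \<rho> *\<^sub>R mat 1"

text \<open>For \<open>\<rho> > 0\<close> and \<open>\<gamma>\<close> in the nonnegative orthant, \<open>model_cov\<close> is Hermitian positive definite.
  Hence \<open>matrix_inv\<close> is the genuine inverse and the complex number below is real; \<open>Re\<close> only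
  changes its type.\<close>

definition cov_obj ::
    "real \<Rightarrow> ('t::finite \<Rightarrow> complex^'n^'m) \<Rightarrow> complex^'g^'n \<Rightarrow> ('t \<Rightarrow> complex^'m)
      \<Rightarrow> real^'g \<Rightarrow> real"
  where "cov_obj \<rho> \<Psi> A x \<gamma> =
    Re (1 / of_nat CARD('t) *
          (\<Sum>s\<in>UNIV. cdot (x s) (matrix_inv (model_cov \<rho> (\<Psi> s) A \<gamma>) *v x s))
        + trace (diag_mat \<gamma>))"

text \<open>Minimisers need not be unique (two atoms may have equal sketches), so arg min is rendered
  as the set of all minimisers.\<close>

definition lasso_minimisers ::
    "real \<Rightarrow> ('t::finite \<Rightarrow> complex^'n^'m) \<Rightarrow> complex^'g^'n \<Rightarrow> ('t \<Rightarrow> complex^'m)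
      \<Rightarrow> (complex^'t^'g) set"
  where "lasso_minimisers \<rho> \<Psi> A x = {C. is_arg_min (lasso_obj \<rho> \<Psi> A x) (\<lambda>C. True) C}"

definition cov_minimisers ::
    "real \<Rightarrow> ('t::finite \<Rightarrow> complex^'n^'m) \<Rightarrow> complex^'g^'n \<Rightarrow> ('t \<Rightarrow> complex^'m)
      \<Rightarrow> (real^'g) set"
  where "cov_minimisers \<rho> \<Psi> A x =
    {\<gamma>. is_arg_min (cov_obj \<rho> \<Psi> A x) (\<lambda>\<gamma>. \<gamma> \<in> nonneg_orthant) \<gamma>}"

definition cov_estimate ::
    "real \<Rightarrow> complex^'n^'m \<Rightarrow> complex^'g^'n \<Rightarrow> real^'g \<Rightarrow> complex^'m \<Rightarrow> complex^'n"
  where "cov_estimate \<rho> P A \<gamma> y =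
    (A ** diag_mat \<gamma> ** A\<^sup>\<dagger> ** P\<^sup>\<dagger> ** matrix_inv (model_cov \<rho> P A \<gamma>)) *v y"

end

theory Submission
  imports Defs
begin

text \<open>Both problems are partial minimisations of one function of \<open>(C, \<gamma>)\<close>,
  \<open>1/T \<Sum>\<^sub>s (\<parallel>x(s) - \<Psi>(s) A c(s)\<parallel>\<^sup>2 / \<rho> + \<Sum>\<^sub>i \<bar>c\<^sub>i(s)\<bar>\<^sup>2 / \<gamma>\<^sub>i) + tr \<Gamma>\<close>.
  Minimising over \<open>C\<close> is a ridge regression with solution
  \<open>c(s) = \<Gamma> A\<^sup>\<dagger> \<Psi>(s)\<^sup>\<dagger> (\<Psi>(s) A \<Gamma> A\<^sup>\<dagger> \<Psi>(s)\<^sup>\<dagger> + \<rho> I)\<^sup>-\<^sup>1 x(s)\<close> and value \<open>g(\<gamma>)\<close>; minimising over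
  \<open>\<gamma>\<close> gives \<open>\<gamma>\<^sub>i = \<parallel>C\<^sub>i\<^sub>,\<^sub>:\<parallel> / \<surd>T\<close>, by the arithmetic-geometric mean inequality, and value
  \<open>2 f(C) / (\<rho> T)\<close>. Hence either partial minimiser map sends minimisers of one problem to
  minimisers of the other, and the uniqueness of the ridge solution identifies \<open>C\<close>.\<close>

section \<open>Adjoints, diagonal weights and the model covariance\<close>

lemma Re_cdot: "Re (cdot x y) = x \<bullet> y"
  by (simp add: cdot_def inner_vec_def inner_complex_def)

lemma cdot_adjoint: "cdot (M *v x) y = cdot x (M\<^sup>\<dagger> *v y)"
proof -
  have "cdot (M *v x) y = (\<Sum>i\<in>UNIV. \<Sum>j\<in>UNIV. cnj (M $ i $ j) * cnj (x $ j) * y $ i)"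
    by (simp add: cdot_def matrix_vector_mult_def sum_distrib_right)
  also have "\<dots> = (\<Sum>j\<in>UNIV. \<Sum>i\<in>UNIV. cnj (M $ i $ j) * cnj (x $ j) * y $ i)"
    by (rule sum.swap)
  also have "\<dots> = cdot x (M\<^sup>\<dagger> *v y)"
    by (simp add: cdot_def matrix_vector_mult_def conj_transpose_def sum_distrib_left mult_ac)
  finally show ?thesis .
qed

lemma inner_adjoint: "(M *v x) \<bullet> y = x \<bullet> (M\<^sup>\<dagger> *v y)"
  by (metis Re_cdot cdot_adjoint)

lemma conj_transpose_mult: "(M ** N)\<^sup>\<dagger> = N\<^sup>\<dagger> ** M\<^sup>\<dagger>"
  by (simp add: conj_transpose_def matrix_matrix_mult_def vec_eq_iff mult.commute)

lemma diag_mat_mult_nth: "(diag_mat \<gamma> *v u) $ i = \<gamma> $ i *\<^sub>R u $ i"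
proof -
  have "(diag_mat \<gamma> *v u) $ i = (\<Sum>j\<in>UNIV. if i = j then complex_of_real (\<gamma> $ i) * u $ j else 0)"
    unfolding matrix_vector_mult_def diag_mat_def vec_lambda_beta by (intro sum.cong) auto
  then show ?thesis
    by (simp add: scaleR_conv_of_real)
qed

lemma trace_diag_mat: "trace (diag_mat \<gamma>) = complex_of_real (\<Sum>i\<in>UNIV. \<gamma> $ i)"
  by (simp add: trace_def diag_mat_def)

lemma model_cov_mult:
  "model_cov \<rho> P A \<gamma> *v y = (P ** A) *v (diag_mat \<gamma> *v ((P ** A)\<^sup>\<dagger> *v y)) + \<rho> *\<^sub>R y"
proof -
  have "(\<rho> *\<^sub>R mat 1 :: complex^'a^'a) *v y = \<rho> *\<^sub>R (mat 1 *v y)"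
    by (simp add: vec_eq_iff matrix_vector_mult_def scaleR_sum_right)
  then show ?thesis
    by (simp add: model_cov_def conj_transpose_mult matrix_vector_mult_add_rdistrib
        matrix_vector_mul_assoc matrix_mul_assoc)
qed

lemma inner_diag_mat_nonneg:
  assumes "\<gamma> \<in> nonneg_orthant"
  shows "0 \<le> u \<bullet> (diag_mat \<gamma> *v u)"
  using assms by (auto simp: inner_vec_def diag_mat_mult_nth nonneg_orthant_def intro!: sum_nonneg)

text \<open>The kernel is trivial: pairing the image of \<open>y\<close> with \<open>y\<close> gives
  a nonnegative quadratic form plus \<open>\<rho>\<close> times the squared norm of
  \<open>y\<close>.\<close>

lemma invertible_model_cov:
  assumes "\<rho> > 0" "\<gamma> \<in> nonneg_orthant"
  shows "invertible (model_cov \<rho> P A \<gamma>)"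
proof -
  have "y = 0" if "model_cov \<rho> P A \<gamma> *v y = 0" for y
  proof -
    let ?u = "(P ** A)\<^sup>\<dagger> *v y"
    have "0 = (model_cov \<rho> P A \<gamma> *v y) \<bullet> y"
      using that by simp
    also have "\<dots> = ?u \<bullet> (diag_mat \<gamma> *v ?u) + \<rho> * (y \<bullet> y)"
      by (simp add: model_cov_mult inner_add_left inner_adjoint[of "P ** A"]
          inner_commute[of "diag_mat \<gamma> *v ?u"])
    finally have "\<rho> * (y \<bullet> y) \<le> 0"
      using inner_diag_mat_nonneg[OF assms(2), of ?u] by linarith
    then show ?thesis
      using \<open>\<rho> > 0\<close> by (metis inner_gt_zero_iff mult_pos_pos not_less)
  qed
  then show ?thesis
    by (metis invertible_left_inverse matrix_left_invertible_ker)
qed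

lemma model_cov_matrix_inv:
  assumes "\<rho> > 0" "\<gamma> \<in> nonneg_orthant"
  shows "model_cov \<rho> P A \<gamma> *v (matrix_inv (model_cov \<rho> P A \<gamma>) *v y) = y"
  \<comment> \<open>\<open>matrix_inv\<close> is a Hilbert choice, so the existence of an inverse
    must be supplied before its defining property can be used.\<close>
  using someI_ex[OF invertible_model_cov[OF assms, of P A, unfolded invertible_def]]
  by (simp add: matrix_vector_mul_assoc matrix_inv_def)

section \<open>Ridge regression for fixed weights\<close>

definition cov_coeffs ::
    "real \<Rightarrow> complex^'n^'m \<Rightarrow> complex^'g^'n \<Rightarrow> real^'g \<Rightarrow> complex^'m \<Rightarrow> complex^'g"
  where "cov_coeffs \<rho> P A \<gamma> y =
    diag_mat \<gamma> *v ((P ** A)\<^sup>\<dagger> *v (matrix_inv (model_cov \<rho> P A \<gamma>) *v y))"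

lemma cov_estimate_eq: "cov_estimate \<rho> P A \<gamma> y = A *v cov_coeffs \<rho> P A \<gamma> y"
  by (simp add: cov_estimate_def cov_coeffs_def conj_transpose_mult matrix_vector_mul_assoc
      matrix_mul_assoc)

text \<open>Division by zero gives \<open>0\<close>, so \<open>ridge\<close> is meaningful only for \<open>c\<close> supported on \<open>\<gamma>\<close>.\<close>

definition ridge :: "real \<Rightarrow> complex^'g^'m \<Rightarrow> real^'g \<Rightarrow> complex^'m \<Rightarrow> complex^'g \<Rightarrow> real"
  where "ridge \<rho> B \<gamma> y c = (norm (y - B *v c))\<^sup>2 / \<rho> + (\<Sum>i\<in>UNIV. (norm (c $ i))\<^sup>2 / \<gamma> $ i)"

definition supported_on :: "real^'g \<Rightarrow> complex^'g \<Rightarrow> bool"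
  where "supported_on \<gamma> c \<longleftrightarrow> (\<forall>i. \<gamma> $ i = 0 \<longrightarrow> c $ i = 0)"

lemma supported_on_cov_coeffs: "supported_on \<gamma> (cov_coeffs \<rho> P A \<gamma> y)"
  by (simp add: supported_on_def cov_coeffs_def diag_mat_mult_nth)

text \<open>Completing the square around the ridge solution \<open>diag_mat \<gamma> *v u\<close>.
  The deviation \<open>d\<close> contributes \<open>- 2 * (d \<bullet> u)\<close> to the data term
  and \<open>2 * (d \<bullet> u)\<close> to the penalty. These cancel, and the terms free of
  \<open>d\<close> add up to \<open>y \<bullet> v\<close>.\<close>

lemma ridge_eq:
  fixes c :: "complex^'g::finite"
  assumes "\<rho> > 0" "\<gamma> \<in> nonneg_orthant" "supported_on \<gamma> c"
  shows "ridge \<rho> (P ** A) \<gamma> y c = y \<bullet> (matrix_inv (model_cov \<rho> P A \<gamma>) *v y)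
    + ridge \<rho> (P ** A) \<gamma> 0 (c - cov_coeffs \<rho> P A \<gamma> y)"
proof -
  define B where "B = P ** A"
  define v where "v = matrix_inv (model_cov \<rho> P A \<gamma>) *v y"
  define u where "u = B\<^sup>\<dagger> *v v"
  define d where "d = c - cov_coeffs \<rho> P A \<gamma> y"
  have c: "c = diag_mat \<gamma> *v u + d"
    by (simp add: d_def cov_coeffs_def u_def v_def B_def)
  \<comment> \<open>The ridge solution leaves the residual \<open>\<rho> *\<^sub>R v\<close>,
    because \<open>v\<close> solves the linear system with matrix \<open>model_cov\<close>.\<close>
  have y: "y = B *v (diag_mat \<gamma> *v u) + \<rho> *\<^sub>R v"
    using model_cov_matrix_inv[OF assms(1,2), of P A y]
    by (simp add: model_cov_mult u_def v_def B_def)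
  have yv: "y \<bullet> v = u \<bullet> (diag_mat \<gamma> *v u) + \<rho> * (v \<bullet> v)"
    by (subst y) (simp add: inner_add_left inner_adjoint[of B] u_def[symmetric]
        inner_commute[of "diag_mat \<gamma> *v u"])
  have *: "y - B *v c = \<rho> *\<^sub>R v - B *v d"
    by (subst y) (simp add: c matrix_vector_right_distrib)
  have "(norm (y - B *v c))\<^sup>2 / \<rho>
      = (\<rho>\<^sup>2 * (v \<bullet> v) - 2 * \<rho> * ((B *v d) \<bullet> v) + (B *v d) \<bullet> (B *v d)) / \<rho>"
    unfolding * power2_norm_eq_inner
    by (simp add: inner_diff_left inner_diff_right inner_commute
        power2_eq_square algebra_simps)
  also have "\<dots> = \<rho> * (v \<bullet> v) - 2 * (d \<bullet> u) + (norm (B *v d))\<^sup>2 / \<rho>"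
    using \<open>\<rho> > 0\<close> unfolding power2_norm_eq_inner
    by (simp add: inner_adjoint[of B d v] u_def field_simps power2_eq_square)
  finally have 1: "(norm (y - B *v c))\<^sup>2 / \<rho>
      = \<rho> * (v \<bullet> v) - 2 * (d \<bullet> u) + (norm (B *v d))\<^sup>2 / \<rho>" .
  have "(norm (c $ i))\<^sup>2 / \<gamma> $ i
      = u $ i \<bullet> (diag_mat \<gamma> *v u) $ i + 2 * (d $ i \<bullet> u $ i) + (norm (d $ i))\<^sup>2 / \<gamma> $ i" for i
  proof (cases "\<gamma> $ i = 0")
    case True
    \<comment> \<open>Both vectors are supported on \<open>\<gamma>\<close>, so at a zero weight
      every term of the identity vanishes.\<close>
    then have "c $ i = 0" "d $ i = 0"
      using assms(3) supported_on_cov_coeffs[of \<gamma> \<rho> P A y] by (simp_all add: supported_on_def d_def)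
    with True show ?thesis by (simp add: diag_mat_mult_nth)
  next
    case False
    have "(norm (c $ i))\<^sup>2
        = (\<gamma> $ i)\<^sup>2 * (u $ i \<bullet> u $ i) + 2 * \<gamma> $ i * (d $ i \<bullet> u $ i) + (norm (d $ i))\<^sup>2"
      unfolding power2_norm_eq_inner
      by (simp add: c diag_mat_mult_nth inner_add_left inner_add_right
          inner_commute power2_eq_square algebra_simps)
    with False show ?thesis
      by (simp add: diag_mat_mult_nth field_simps power2_eq_square)
  qed
  then have 2: "(\<Sum>i\<in>UNIV. (norm (c $ i))\<^sup>2 / \<gamma> $ i)
      = u \<bullet> (diag_mat \<gamma> *v u) + 2 * (d \<bullet> u) + (\<Sum>i\<in>UNIV. (norm (d $ i))\<^sup>2 / \<gamma> $ i)"
    by (simp add: sum.distrib inner_vec_def sum_distrib_left)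
  show ?thesis
    using 1 2 yv by (simp add: ridge_def B_def[symmetric] v_def[symmetric] d_def[symmetric])
qed

lemma ridge_nonneg:
  assumes "\<rho> > 0" "\<gamma> \<in> nonneg_orthant"
  shows "0 \<le> ridge \<rho> B \<gamma> y c"
  using assms by (auto simp: ridge_def nonneg_orthant_def intro!: add_nonneg_nonneg sum_nonneg)

text \<open>This is the source of uniqueness. A zero penalty forces \<open>c $ i = 0\<close> only
  where the weight is nonzero; the support condition covers the other entries.\<close>

lemma ridge_zero_data_eq_0D:
  assumes "\<rho> > 0" "\<gamma> \<in> nonneg_orthant" "supported_on \<gamma> c" "ridge \<rho> B \<gamma> 0 c = 0"
  shows "c = 0"
proof -
  have nn: "0 \<le> (norm (c $ i))\<^sup>2 / \<gamma> $ i" for i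
    using assms(2) by (simp add: nonneg_orthant_def)
  have "0 \<le> (norm (0 - B *v c))\<^sup>2 / \<rho>"
    using assms(1) by simp
  then have "(\<Sum>i\<in>UNIV. (norm (c $ i))\<^sup>2 / \<gamma> $ i) = 0"
    using assms(4) sum_nonneg[of UNIV "\<lambda>i. (norm (c $ i))\<^sup>2 / \<gamma> $ i"] nn
    unfolding ridge_def by (smt (verit))
  then have "(norm (c $ i))\<^sup>2 / \<gamma> $ i = 0" for i
    using nn by (simp add: sum_nonneg_eq_0_iff)
  then show ?thesis
    using assms(3) by (auto simp: supported_on_def vec_eq_iff)
qed

section \<open>The joint objective and elimination of the coefficients\<close>

definition joint_obj ::
    "real \<Rightarrow> ('t::finite \<Rightarrow> complex^'n^'m) \<Rightarrow> complex^'g^'n \<Rightarrow> ('t \<Rightarrow> complex^'m)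
      \<Rightarrow> complex^'t^'g \<Rightarrow> real^'g \<Rightarrow> real"
  where "joint_obj \<rho> \<Psi> A x C \<gamma> =
    (\<Sum>s\<in>UNIV. ridge \<rho> (\<Psi> s ** A) \<gamma> (x s) (column s C)) / CARD('t) + (\<Sum>i\<in>UNIV. \<gamma> $ i)"

definition coeff_matrix ::
    "real \<Rightarrow> ('t::finite \<Rightarrow> complex^'n^'m) \<Rightarrow> complex^'g^'n \<Rightarrow> ('t \<Rightarrow> complex^'m)
      \<Rightarrow> real^'g \<Rightarrow> complex^'t^'g"
  where "coeff_matrix \<rho> \<Psi> A x \<gamma> = (\<chi> i s. cov_coeffs \<rho> (\<Psi> s) A \<gamma> (x s) $ i)"

definition row_weights :: "complex^'t^'g \<Rightarrow> real^'g"
  where "row_weights C = (\<chi> i. norm (row i C) / sqrt CARD('t))"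

lemma column_coeff_matrix: "column s (coeff_matrix \<rho> \<Psi> A x \<gamma>) = cov_coeffs \<rho> (\<Psi> s) A \<gamma> (x s)"
  by (simp add: column_def coeff_matrix_def vec_eq_iff)

lemma row_weights_nonneg: "row_weights C \<in> nonneg_orthant"
  by (simp add: row_weights_def nonneg_orthant_def)

lemma supported_on_row_weights: "supported_on (row_weights C) (column s C)"
  by (auto simp: supported_on_def row_weights_def column_def row_def vec_eq_iff)

lemma cov_obj_eq:
  "cov_obj \<rho> \<Psi> A x \<gamma> =
    (\<Sum>s\<in>UNIV. x s \<bullet> (matrix_inv (model_cov \<rho> (\<Psi> s) A \<gamma>) *v x s)) / CARD('t)
      + (\<Sum>i\<in>UNIV. \<gamma> $ i)"
  for \<Psi> :: "'t::finite \<Rightarrow> complex^'n^'m"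
proof -
  have *: "Re (1 / of_nat N * w) = Re w / real N" for N w
    by (simp add: Re_divide_of_nat)
  show ?thesis
    unfolding cov_obj_def plus_complex.sel * by (simp add: Re_cdot trace_diag_mat)
qed

text \<open>The excess over \<open>cov_obj\<close> is a sum of ridge objectives with zero data,
  taken at the deviations from \<open>cov_coeffs\<close>. Its nonnegativity gives the lower bound,
  its definiteness the uniqueness of \<open>C\<close>.\<close>

lemma joint_obj_eq_cov_obj:
  fixes \<rho> :: real and \<Psi> :: "'t::finite \<Rightarrow> complex^'n^'m"
  assumes "\<rho> > 0" "\<gamma> \<in> nonneg_orthant" "\<And>s. supported_on \<gamma> (column s C)"
  shows "joint_obj \<rho> \<Psi> A x C \<gamma> = cov_obj \<rho> \<Psi> A x \<gamma>
    + (\<Sum>s\<in>UNIV. ridge \<rho> (\<Psi> s ** A) \<gamma> 0 (column s C - cov_coeffs \<rho> (\<Psi> s) A \<gamma> (x s))) / CARD('t)"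
  by (simp add: joint_obj_def cov_obj_eq ridge_eq[OF assms] sum.distrib add_divide_distrib)

lemma cov_obj_le_joint_obj:
  assumes "\<rho> > 0" "\<gamma> \<in> nonneg_orthant" "\<And>s. supported_on \<gamma> (column s C)"
  shows "cov_obj \<rho> \<Psi> A x \<gamma> \<le> joint_obj \<rho> \<Psi> A x C \<gamma>"
  using assms by (simp add: joint_obj_eq_cov_obj ridge_nonneg sum_nonneg)

lemma joint_obj_coeff_matrix:
  assumes "\<rho> > 0" "\<gamma> \<in> nonneg_orthant"
  shows "joint_obj \<rho> \<Psi> A x (coeff_matrix \<rho> \<Psi> A x \<gamma>) \<gamma> = cov_obj \<rho> \<Psi> A x \<gamma>"
  using assms
  by (simp add: joint_obj_eq_cov_obj column_coeff_matrix supported_on_cov_coeffs ridge_def)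

lemma column_eq_cov_coeffs:
  assumes "\<rho> > 0" "\<gamma> \<in> nonneg_orthant" "\<And>s. supported_on \<gamma> (column s C)"
    and "joint_obj \<rho> \<Psi> A x C \<gamma> = cov_obj \<rho> \<Psi> A x \<gamma>"
  shows "column s C = cov_coeffs \<rho> (\<Psi> s) A \<gamma> (x s)"
proof -
  let ?d = "\<lambda>s. column s C - cov_coeffs \<rho> (\<Psi> s) A \<gamma> (x s)"
  have "(\<Sum>s\<in>UNIV. ridge \<rho> (\<Psi> s ** A) \<gamma> 0 (?d s)) = 0"
    using assms(4) joint_obj_eq_cov_obj[OF assms(1-3), of \<Psi> A x] by simp
  then have "ridge \<rho> (\<Psi> s ** A) \<gamma> 0 (?d s) = 0"
    using assms(1,2) by (simp add: sum_nonneg_eq_0_iff ridge_nonneg)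
  moreover have "supported_on \<gamma> (?d s)"
    using assms(3)[of s] supported_on_cov_coeffs[of \<gamma> \<rho> "\<Psi> s" A "x s"]
    by (simp add: supported_on_def)
  ultimately have "?d s = 0"
    using ridge_zero_data_eq_0D assms(1,2) by blast
  then show ?thesis by simp
qed

section \<open>Elimination of the weights\<close>

lemma norm_row_power2: "(norm (row i C))\<^sup>2 = (\<Sum>s\<in>UNIV. (norm (column s C $ i))\<^sup>2)"
  by (simp add: norm_vec_def L2_set_def sum_nonneg row_def column_def)

text \<open>Exchanging the sums groups the penalty by rows, so that each \<open>\<gamma> $ i\<close>
  can be optimised separately.\<close>

lemma joint_obj_eq_rows:
  fixes \<rho> :: real and \<Psi> :: "'t::finite \<Rightarrow> complex^'n^'m"
  shows "joint_obj \<rho> \<Psi> A x C \<gamma> =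
    (\<Sum>s\<in>UNIV. (norm (x s - (\<Psi> s ** A) *v column s C))\<^sup>2) / (\<rho> * CARD('t))
      + (\<Sum>i\<in>UNIV. (norm (row i C) / sqrt CARD('t))\<^sup>2 / \<gamma> $ i + \<gamma> $ i)"
proof -
  have "(\<Sum>s\<in>UNIV. \<Sum>i\<in>UNIV. (norm (column s C $ i))\<^sup>2 / \<gamma> $ i)
      = (\<Sum>i\<in>UNIV. (norm (row i C))\<^sup>2 / \<gamma> $ i)"
    unfolding norm_row_power2 sum_divide_distrib by (rule sum.swap)
  then show ?thesis
    by (simp add: joint_obj_def ridge_def sum.distrib add_divide_distrib power_divide
        sum_divide_distrib mult.commute)
qed

text \<open>The factor makes the data term that of \<open>joint_obj_eq_rows\<close>. With
  \<open>r\<close> the row norm over \<open>sqrt CARD('t)\<close>, it remains to compare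
  \<open>2 * r\<close> with \<open>r\<^sup>2 / \<gamma> $ i + \<gamma> $ i\<close>.\<close>

lemma scaled_lasso_obj_eq:
  fixes \<rho> :: real and \<Psi> :: "'t::finite \<Rightarrow> complex^'n^'m"
  assumes "\<rho> > 0"
  shows "2 / (\<rho> * CARD('t)) * lasso_obj \<rho> \<Psi> A x C =
    (\<Sum>s\<in>UNIV. (norm (x s - (\<Psi> s ** A) *v column s C))\<^sup>2) / (\<rho> * CARD('t))
      + (\<Sum>i\<in>UNIV. 2 * (norm (row i C) / sqrt CARD('t)))"
proof -
  have *: "2 / (\<rho> * N) * (1/2 * S + \<rho> * sqrt N * R) = S / (\<rho> * N) + 2 * R / sqrt N"
    if "N > 0" for N S R :: real
  proof -
    have "sqrt N / N = 1 / sqrt N"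
      using that by (simp add: real_div_sqrt divide_simps)
    then show ?thesis
      using that assms by (simp add: field_simps)
  qed
  show ?thesis
    unfolding lasso_obj_def by (subst *) (simp_all add: norm21_def sum_distrib_left sum_divide_distrib)
qed

lemma lasso_obj_le_joint_obj:
  fixes \<rho> :: real and \<Psi> :: "'t::finite \<Rightarrow> complex^'n^'m"
  assumes "\<rho> > 0" "\<gamma> \<in> nonneg_orthant" "\<And>s. supported_on \<gamma> (column s C)"
  shows "2 / (\<rho> * CARD('t)) * lasso_obj \<rho> \<Psi> A x C \<le> joint_obj \<rho> \<Psi> A x C \<gamma>"
proof -
  have "2 * r \<le> r\<^sup>2 / \<gamma> $ i + \<gamma> $ i" if "r = norm (row i C) / sqrt CARD('t)" for r i
  proof (cases "\<gamma> $ i = 0")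
    case True
    \<comment> \<open>The support condition excludes a nonzero row at zero weight, where the
      convention for division by zero would break the inequality.\<close>
    then have "row i C = 0"
      using assms(3) by (simp add: supported_on_def column_def row_def vec_eq_iff)
    with True that show ?thesis by simp
  next
    case False
    then have pos: "\<gamma> $ i > 0"
      using assms(2) by (simp add: nonneg_orthant_def less_le)
    have "r\<^sup>2 / \<gamma> $ i + \<gamma> $ i - 2 * r = (r - \<gamma> $ i)\<^sup>2 / \<gamma> $ i"
      using pos by (simp add: field_simps power2_eq_square)
    also have "\<dots> \<ge> 0"
      using pos by simp
    finally show ?thesis by simp
  qed
  then show ?thesis
    unfolding scaled_lasso_obj_eq[OF assms(1)] joint_obj_eq_rows by (simp add: sum_mono)
qed

lemma joint_obj_row_weights:
  fixes \<rho> :: real and \<Psi> :: "'t::finite \<Rightarrow> complex^'n^'m"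
  assumes "\<rho> > 0"
  shows "joint_obj \<rho> \<Psi> A x C (row_weights C) = 2 / (\<rho> * CARD('t)) * lasso_obj \<rho> \<Psi> A x C"
proof -
  \<comment> \<open>Equality case of the arithmetic-geometric mean inequality; at
    \<open>r = 0\<close> it holds because \<open>0 / 0 = 0\<close>.\<close>
  have "r\<^sup>2 / r + r = 2 * r" for r :: real
    by (simp add: power2_eq_square)
  then show ?thesis
    unfolding scaled_lasso_obj_eq[OF assms] joint_obj_eq_rows row_weights_def vec_lambda_beta
    by presburger
qed

section \<open>Transfer of minimisers in both directions\<close>

lemma lasso_minimiser_cov:
  fixes \<rho> :: real and \<Psi> :: "'t::finite \<Rightarrow> complex^'n^'m"
  assumes "\<rho> > 0" "C \<in> lasso_minimisers \<rho> \<Psi> A x"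
  shows "row_weights C \<in> cov_minimisers \<rho> \<Psi> A x"
    and "column s C = cov_coeffs \<rho> (\<Psi> s) A (row_weights C) (x s)"
proof -
  let ?J = "joint_obj \<rho> \<Psi> A x" and ?\<kappa> = "2 / (\<rho> * CARD('t))" and ?C = "coeff_matrix \<rho> \<Psi> A x"
  have min: "lasso_obj \<rho> \<Psi> A x C \<le> lasso_obj \<rho> \<Psi> A x C'" for C'
    using assms(2) by (auto simp: lasso_minimisers_def is_arg_min_linorder)
  \<comment> \<open>Any competitor \<open>\<gamma>\<close> is turned into the competitor
    \<open>?C \<gamma>\<close> for the lasso problem, where minimality of \<open>C\<close>
    applies.\<close>
  have le: "?J C (row_weights C) \<le> cov_obj \<rho> \<Psi> A x \<gamma>" if "\<gamma> \<in> nonneg_orthant" for \<gamma>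
  proof -
    have "?J C (row_weights C) = ?\<kappa> * lasso_obj \<rho> \<Psi> A x C"
      using assms(1) by (rule joint_obj_row_weights)
    also have "\<dots> \<le> ?\<kappa> * lasso_obj \<rho> \<Psi> A x (?C \<gamma>)"
      using assms(1) by (intro mult_left_mono min) simp
    also have "\<dots> \<le> ?J (?C \<gamma>) \<gamma>"
      using assms(1) that
      by (intro lasso_obj_le_joint_obj) (simp_all add: column_coeff_matrix supported_on_cov_coeffs)
    also have "\<dots> = cov_obj \<rho> \<Psi> A x \<gamma>"
      using assms(1) that by (rule joint_obj_coeff_matrix)
    finally show ?thesis .
  qed
  have ge: "cov_obj \<rho> \<Psi> A x (row_weights C) \<le> ?J C (row_weights C)"
    using assms(1) row_weights_nonneg supported_on_row_weights by (rule cov_obj_le_joint_obj)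
  show "row_weights C \<in> cov_minimisers \<rho> \<Psi> A x"
    unfolding cov_minimisers_def is_arg_min_linorder mem_Collect_eq
    using order_trans[OF ge le] row_weights_nonneg by blast
  show "column s C = cov_coeffs \<rho> (\<Psi> s) A (row_weights C) (x s)"
    using assms(1) row_weights_nonneg supported_on_row_weights
  proof (rule column_eq_cov_coeffs)
    \<comment> \<open>Taking \<open>row_weights C\<close> itself as the competitor closes the chain,
      so \<open>C\<close> attains the ridge minimum for these weights.\<close>
    show "?J C (row_weights C) = cov_obj \<rho> \<Psi> A x (row_weights C)"
      using ge le[OF row_weights_nonneg] by (rule antisym[rotated])
  qed
qed

text \<open>The mirror image of the previous chain: a competitor \<open>C\<close> is turned into the
  competitor \<open>row_weights C\<close>.\<close>

lemma cov_minimiser_lasso: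
  fixes \<rho> :: real and \<Psi> :: "'t::finite \<Rightarrow> complex^'n^'m"
  assumes "\<rho> > 0" "\<gamma> \<in> cov_minimisers \<rho> \<Psi> A x"
  shows "coeff_matrix \<rho> \<Psi> A x \<gamma> \<in> lasso_minimisers \<rho> \<Psi> A x"
proof -
  let ?J = "joint_obj \<rho> \<Psi> A x" and ?\<kappa> = "2 / (\<rho> * CARD('t))" and ?C = "coeff_matrix \<rho> \<Psi> A x \<gamma>"
  have \<gamma>: "\<gamma> \<in> nonneg_orthant"
    and min: "\<And>\<gamma>'. \<gamma>' \<in> nonneg_orthant \<Longrightarrow> cov_obj \<rho> \<Psi> A x \<gamma> \<le> cov_obj \<rho> \<Psi> A x \<gamma>'"
    using assms(2) by (auto simp: cov_minimisers_def is_arg_min_linorder)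
  have "lasso_obj \<rho> \<Psi> A x ?C \<le> lasso_obj \<rho> \<Psi> A x C" for C
  proof -
    have "?\<kappa> * lasso_obj \<rho> \<Psi> A x ?C \<le> ?J ?C \<gamma>"
      using assms(1) \<gamma>
      by (intro lasso_obj_le_joint_obj) (simp_all add: column_coeff_matrix supported_on_cov_coeffs)
    also have "\<dots> = cov_obj \<rho> \<Psi> A x \<gamma>"
      using assms(1) \<gamma> by (rule joint_obj_coeff_matrix)
    also have "\<dots> \<le> cov_obj \<rho> \<Psi> A x (row_weights C)"
      by (intro min row_weights_nonneg)
    also have "\<dots> \<le> ?J C (row_weights C)"
      using assms(1) row_weights_nonneg supported_on_row_weights by (rule cov_obj_le_joint_obj)
    also have "\<dots> = ?\<kappa> * lasso_obj \<rho> \<Psi> A x C"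
      using assms(1) by (rule joint_obj_row_weights)
    finally show ?thesis
      by (rule mult_left_le_imp_le) (simp add: assms(1))
  qed
  then show ?thesis
    by (simp add: lasso_minimisers_def is_arg_min_linorder)
qed

text \<open>Distinct atoms may have equal sketches, so even the estimate can depend on the chosen
  minimiser. An arbitrary pair is therefore matched when the lasso estimate is unique; in general
  each minimiser of one problem has a partner in the other.\<close>

theorem theorem2:
  fixes \<rho> :: real
    and \<Psi> :: "'t::finite \<Rightarrow> complex^'n^'m"
    and \<Xi> :: "'l set" and a :: "'l \<Rightarrow> complex^'n"
    and grid :: "'g::finite \<Rightarrow> 'l" and A :: "complex^'g^'n"
    and k :: nat and \<xi> :: "nat \<Rightarrow> 'l" and w :: "nat \<Rightarrow> 't \<Rightarrow> complex"
    and h :: "'t \<Rightarrow> complex^'n" and x z :: "'t \<Rightarrow> complex^'m"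
  assumes "\<rho> > 0"
    and "\<And>s. \<Psi> s ** (\<Psi> s)\<^sup>\<dagger> = mat 1"
    and "range grid \<subseteq> \<Xi>" and "A = dictionary a grid"
    and "\<xi> ` {1..k} \<subseteq> \<Xi>" and "\<And>s. h s = (\<Sum>i=1..k. w i s *s a (\<xi> i))"
    and "\<And>s. x s = \<Psi> s *v h s + z s"
  shows
    "(\<forall>C \<in> lasso_minimisers \<rho> \<Psi> A x. \<forall>\<gamma> \<in> cov_minimisers \<rho> \<Psi> A x.
        (\<forall>C' \<in> lasso_minimisers \<rho> \<Psi> A x. \<forall>s. A *v column s C' = A *v column s C) \<longrightarrow>
        (\<forall>s. A *v column s C = cov_estimate \<rho> (\<Psi> s) A \<gamma> (x s)))
   \<and> (\<forall>C \<in> lasso_minimisers \<rho> \<Psi> A x. \<exists>\<gamma> \<in> cov_minimisers \<rho> \<Psi> A x.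
        \<forall>s. A *v column s C = cov_estimate \<rho> (\<Psi> s) A \<gamma> (x s))
   \<and> (\<forall>\<gamma> \<in> cov_minimisers \<rho> \<Psi> A x. \<exists>C \<in> lasso_minimisers \<rho> \<Psi> A x.
        \<forall>s. A *v column s C = cov_estimate \<rho> (\<Psi> s) A \<gamma> (x s))"
proof -
  have lasso: "\<exists>\<gamma> \<in> cov_minimisers \<rho> \<Psi> A x. \<forall>s. A *v column s C = cov_estimate \<rho> (\<Psi> s) A \<gamma> (x s)"
    if "C \<in> lasso_minimisers \<rho> \<Psi> A x" for C
    using lasso_minimiser_cov[OF \<open>\<rho> > 0\<close> that] by (metis cov_estimate_eq)
  have cov: "\<exists>C \<in> lasso_minimisers \<rho> \<Psi> A x. \<forall>s. A *v column s C = cov_estimate \<rho> (\<Psi> s) A \<gamma> (x s)"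
    if "\<gamma> \<in> cov_minimisers \<rho> \<Psi> A x" for \<gamma>
    using cov_minimiser_lasso[OF \<open>\<rho> > 0\<close> that] by (metis cov_estimate_eq column_coeff_matrix)
  show ?thesis
  proof (intro conjI ballI impI)
    fix C \<gamma>
    assume \<gamma>: "\<gamma> \<in> cov_minimisers \<rho> \<Psi> A x"
      and C: "\<forall>C' \<in> lasso_minimisers \<rho> \<Psi> A x. \<forall>s. A *v column s C' = A *v column s C"
    \<comment> \<open>The partner \<open>C'\<close> of \<open>\<gamma>\<close> satisfies the
      formula, and the assumed uniqueness of the estimate carries it over to
      \<open>C\<close>.\<close>
    obtain C' where "C' \<in> lasso_minimisers \<rho> \<Psi> A x"
      and "\<forall>s. A *v column s C' = cov_estimate \<rho> (\<Psi> s) A \<gamma> (x s)"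
      using cov[OF \<gamma>] by blast
    with C show "\<forall>s. A *v column s C = cov_estimate \<rho> (\<Psi> s) A \<gamma> (x s)"
      by simp
  qed (fact lasso cov)+
qed

end
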